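(* Let $(H,E,\mu)$ be any abstract Wiener space (with $H\neq\{0\}$) such that $E$ is a Hilbert space and the embedding $H\subset E$ is Hilbert–Schmidt. Let $\alpha\in(0,2)$. Then there exists a non-trivial Lévy measure $\Delta_\alpha$ on $E$ such that $$\forall\xi\in E^*,\qquad-\|S\xi\|_H^{\alpha}=2\int_E\left(\cos\langle\xi,x\rangle-1\right)\Delta_\alpha(\mathrm{d}x),$$ and which can be radially decomposed as follows: there is a finite measure $\sigma_\alpha$ on the Borel sets of $\mathcal{S}=\{x\in E:\|x\|_E=1\}$ such that for every Borel set $B$ of $E$, $$\Delta_\alpha(B)=\int_0^\infty\frac{\mathrm{d}r}{r^{1+\alpha}}\int_{\mathcal{S}}\mathbf{1}_B(ry)\,\sigma_\alpha(\mathrm{d}y).$$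
   Context: Abstract Wiener space $(H,E,\mu)$: $E$ is a separable real Banach space, $\mu$ is a centred Gaussian measure on $E$, and $H$ is a separable real Hilbert space densely and continuously embedded in $E$ which is the Cameron–Martin space of $\mu$. The covariance operator $S$ is defined on $E^*$ by $S\xi=\int_E x\,\langle\xi,x\rangle\,\mu(\mathrm{d}x)$; it takes values in $H$, $(S\xi,S\xi')_H=\int_E\langle\xi,x\rangle\langle\xi',x\rangle\,\mu(\mathrm{d}x)$, and $H$ is the completion of $S(E^* )$ for this scalar product. A Lévy measure on $E$ is a Borel measure $\Delta$ with $\Delta(\{0\})=0$ and $\int_E(1\wedge\|x\|_E^2)\,\Delta(\mathrm{d}x)<\infty$. *)

theory Defs
  imports "HOL-Probability.Probability"
begin

text \<open>
  The topological dual of a real normed space \<open>'e\<close> is the type of bounded linear maps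
  \<open>'e \<Rightarrow>\<^sub>L real\<close>. Separable Banach spaces are types of sort
  \<open>{banach, second_countable_topology}\<close>; separable Hilbert spaces are in addition of
  sort \<open>real_inner\<close>.
\<close>

text \<open>The centred normal law on the line with standard deviation \<open>s\<close>; \<open>s = 0\<close> gives the
  Dirac mass at the origin.\<close>

definition centred_normal :: "real \<Rightarrow> real measure" where
  "centred_normal s =
     (if s = 0 then return borel 0 else density lborel (\<lambda>x. ennreal (normal_density 0 s x)))"

definition centred_gaussian_measure ::
    "'e::{banach, second_countable_topology} measure \<Rightarrow> bool" where
  "centred_gaussian_measure \<mu> \<longleftrightarrow>
     prob_space \<mu> \<and> sets \<mu> = sets borel \<and>
     (\<forall>\<xi> :: 'e \<Rightarrow>\<^sub>L real. \<exists>s\<ge>0. distr \<mu> borel (blinfun_apply \<xi>) = centred_normal s)"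

definition covariance_operator ::
    "'e::{banach, second_countable_topology} measure \<Rightarrow> ('e \<Rightarrow>\<^sub>L real) \<Rightarrow> 'e" where
  "covariance_operator \<mu> \<xi> = (\<integral>x. blinfun_apply \<xi> x *\<^sub>R x \<partial>\<mu>)"

text \<open>The inclusion of \<open>H\<close> in \<open>E\<close> is an injective map \<open>\<iota> :: 'h \<Rightarrow> 'e\<close> between types, so the
  covariance operator, viewed with values in \<open>H\<close>, is its composition with the inverse of \<open>\<iota>\<close>.
  This is meaningful when the covariance operator takes its values in the range of \<open>\<iota>\<close>.\<close>

definition covariance_in ::
    "('h \<Rightarrow> 'e::{banach, second_countable_topology}) \<Rightarrow> 'e measure \<Rightarrow> ('e \<Rightarrow>\<^sub>L real) \<Rightarrow> 'h" where
  "covariance_in \<iota> \<mu> \<xi> = inv \<iota> (covariance_operator \<mu> \<xi>)"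

text \<open>The last three assumptions say that \<open>H\<close> is the Cameron--Martin space of \<open>\<mu>\<close>: it is complete
  and contains the range of the covariance operator as a dense subspace, on which the scalar
  product is given by the covariance of \<open>\<mu>\<close>.\<close>

locale abstract_wiener_space =
  fixes \<iota> :: "'h::{real_inner, banach, second_countable_topology}
                \<Rightarrow> 'e::{banach, second_countable_topology}"
    and \<mu> :: "'e measure"
  assumes gaussian: "centred_gaussian_measure \<mu>"
    and embedding_bounded_linear: "bounded_linear \<iota>"
    and embedding_inj: "inj \<iota>"
    and embedding_dense: "closure (range \<iota>) = UNIV"
    and covariance_range: "range (covariance_operator \<mu>) \<subseteq> range \<iota>"
    and covariance_inner:
      "\<And>\<xi> \<xi>'. inner (covariance_in \<iota> \<mu> \<xi>) (covariance_in \<iota> \<mu> \<xi>')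
                = (\<integral>x. blinfun_apply \<xi> x * blinfun_apply \<xi>' x \<partial>\<mu>)"
    and covariance_dense: "closure (range (covariance_in \<iota> \<mu>)) = UNIV"

definition orthonormal_basis :: "'h::real_inner set \<Rightarrow> bool" where
  "orthonormal_basis B \<longleftrightarrow>
     pairwise orthogonal B \<and> (\<forall>b\<in>B. norm b = 1) \<and> closure (span B) = UNIV"

text \<open>The sum below does not depend on the choice of the orthonormal basis.\<close>

definition hilbert_schmidt :: "('h::real_inner \<Rightarrow> 'e::real_inner) \<Rightarrow> bool" where
  "hilbert_schmidt T \<longleftrightarrow>
     bounded_linear T \<and>
     (\<exists>B. orthonormal_basis B \<and> (\<lambda>b. (norm (T b))\<^sup>2) summable_on B)"

definition levy_measure :: "'e::real_normed_vector measure \<Rightarrow> bool" where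
  "levy_measure \<Delta> \<longleftrightarrow>
     sets \<Delta> = sets borel \<and> emeasure \<Delta> {0} = 0 \<and>
     (\<integral>\<^sup>+x. ennreal (min 1 ((norm x)\<^sup>2)) \<partial>\<Delta>) < \<infinity>"

end

theory Submission
  imports Defs
begin

text \<open>Take \<open>\<Delta>\<close> to be the multiple \<open>c\<close> of the image of \<open>ds / s\<^bsup>1 + \<alpha>\<^esup> \<otimes> \<mu>\<close> under \<open>(s, x) \<mapsto> s x\<close>;
  in polar coordinates this is the radial measure over the image \<open>\<sigma>\<close> of \<open>c \<parallel>x\<parallel>\<^sup>\<alpha> \<mu>(dx)\<close> under \<open>x \<mapsto> x / \<parallel>x\<parallel>\<close>. By Tonelli and
  scaling, \<open>\<integral>(1 - cos \<langle>\<xi>, x\<rangle>) d\<Delta> = c K \<integral>|\<langle>\<xi>, x\<rangle>|\<^sup>\<alpha> d\<mu> = c K m \<parallel>S\<xi>\<parallel>\<^sup>\<alpha>\<close>, where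
  \<open>K = \<integral>\<^sub>0\<^sup>\<infinity> (1 - cos r) dr / r\<^bsup>1 + \<alpha>\<^esup>\<close> and \<open>m\<close> is the absolute moment of order \<open>\<alpha>\<close> of the standard normal law.
  Finiteness of \<open>\<sigma>\<close> follows from \<open>\<integral>\<parallel>x\<parallel>\<^sup>2 d\<mu> < \<infinity>\<close>: as \<open>S\<close> is the adjoint of the embedding \<open>\<iota>\<close>, this
  integral is at most the squared Hilbert--Schmidt norm of \<open>\<iota>\<close>.\<close>

subsection \<open>Scalar integrals\<close>

text \<open>The indicator builds the half-line into the weight, so that radial integrals run over
  all of \<open>lborel\<close> and a scaling substitution leaves the domain alone.\<close>

definition radial_density :: "real \<Rightarrow> real \<Rightarrow> ennreal" where
  "radial_density \<alpha> r = ennreal (1 / r powr (1 + \<alpha>)) * indicator {0<..} r"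

lemma radial_density_measurable [measurable]: "radial_density \<alpha> \<in> borel_measurable borel"
  unfolding radial_density_def by measurable

lemma radial_density_scale:
  assumes "c > 0"
  shows "radial_density \<alpha> (c * r) = ennreal (c powr (- 1 - \<alpha>)) * radial_density \<alpha> r"
proof (cases "r > 0")
  case True
  have "1 / (c * r) powr (1 + \<alpha>) = c powr (- 1 - \<alpha>) * (1 / r powr (1 + \<alpha>))"
    using assms True powr_minus[of c "1 + \<alpha>"] by (simp add: powr_mult field_simps)
  then show ?thesis
    using assms True by (simp add: radial_density_def ennreal_mult[symmetric])
next
  case False
  then show ?thesis
    using assms by (auto simp: radial_density_def zero_less_mult_iff)
qed

text \<open>The substitution contributes a Jacobian \<open>t\<close> and the weight, homogeneous of
  degree \<open>- 1 - \<alpha>\<close>, the rest of the factor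
  \<open>t powr (- \<alpha>)\<close>.\<close>

lemma nn_integral_radial_density_scale:
  assumes [measurable]: "f \<in> borel_measurable borel" and "t > 0"
  shows "(\<integral>\<^sup>+r. radial_density \<alpha> r * f (t * r) \<partial>lborel)
       = ennreal (t powr \<alpha>) * (\<integral>\<^sup>+r. radial_density \<alpha> r * f r \<partial>lborel)"
proof -
  have "(\<integral>\<^sup>+r. radial_density \<alpha> r * f r \<partial>lborel)
      = ennreal t * (\<integral>\<^sup>+r. radial_density \<alpha> (t * r) * f (t * r) \<partial>lborel)"
    using assms by (subst nn_integral_real_affine[where c=t and t=0]) auto
  also have "\<dots> = ennreal t * ennreal (t powr (- 1 - \<alpha>)) * (\<integral>\<^sup>+r. radial_density \<alpha> r * f (t * r) \<partial>lborel)"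
    using assms by (simp add: radial_density_scale nn_integral_cmult mult.assoc)
  also have "ennreal t * ennreal (t powr (- 1 - \<alpha>)) = ennreal (t powr (- \<alpha>))"
    using assms powr_add[of t 1 "- 1 - \<alpha>"] by (simp add: ennreal_mult[symmetric])
  \<comment> \<open>Instead of dividing in \<open>ennreal\<close>, both sides are multiplied by the
    reciprocal power.\<close>
  finally have "ennreal (t powr \<alpha>) * (\<integral>\<^sup>+r. radial_density \<alpha> r * f r \<partial>lborel)
      = ennreal (t powr \<alpha>) * ennreal (t powr (- \<alpha>)) * (\<integral>\<^sup>+r. radial_density \<alpha> r * f (t * r) \<partial>lborel)"
    by (simp add: mult.assoc)
  also have "ennreal (t powr \<alpha>) * ennreal (t powr (- \<alpha>)) = 1"
    using assms by (simp add: ennreal_mult[symmetric] powr_add[symmetric])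
  finally show ?thesis by simp
qed

text \<open>Near 0 the integrand is \<open>r powr (1 - \<alpha>)\<close>, integrable as \<alpha> <
  2; beyond 1 it is \<open>r powr (- 1 - \<alpha>)\<close>, integrable as \<alpha> > 0.\<close>

lemma nn_integral_radial_density_min_finite:
  assumes "0 < \<alpha>" "\<alpha> < 2"
  shows "(\<integral>\<^sup>+r. radial_density \<alpha> r * ennreal (min 1 (r\<^sup>2)) \<partial>lborel) < \<infinity>"
proof -
  have "radial_density \<alpha> r * ennreal (min 1 (r\<^sup>2))
      \<le> ennreal (r powr (1 - \<alpha>)) * indicator {0..1} r
        + ennreal (r powr (- 1 - \<alpha>)) * indicator {1..} r" for r
  proof (cases "r > 0")
    case True
    have inv: "1 / r powr (1 + \<alpha>) = r powr (- 1 - \<alpha>)"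
      using powr_minus[of r "1 + \<alpha>"] by (simp add: field_simps)
    have "r powr (- 1 - \<alpha>) * r\<^sup>2 = r powr (1 - \<alpha>)"
      using True powr_add[of r "- 1 - \<alpha>" 2] by simp
    moreover have "min 1 (r\<^sup>2) = (if r \<le> 1 then r\<^sup>2 else 1)"
      using True one_le_power[of r 2] power_le_one[of r 2] by (auto simp: min_def intro: antisym)
    ultimately show ?thesis
      using True by (auto simp: radial_density_def inv ennreal_mult[symmetric])
  qed (simp add: radial_density_def)
  then have "(\<integral>\<^sup>+r. radial_density \<alpha> r * ennreal (min 1 (r\<^sup>2)) \<partial>lborel)
      \<le> (\<integral>\<^sup>+r. ennreal (r powr (1 - \<alpha>)) * indicator {0..1} r \<partial>lborel)
        + (\<integral>\<^sup>+r. ennreal (r powr (- 1 - \<alpha>)) * indicator {1..} r \<partial>lborel)"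
    by (subst nn_integral_add[symmetric]) (auto intro!: nn_integral_mono)
  also have "(\<integral>\<^sup>+r. ennreal (r powr (1 - \<alpha>)) * indicator {0..1} r \<partial>lborel)
      = ennreal (1 powr (1 - \<alpha> + 1) / (1 - \<alpha> + 1))"
    using assms by (intro nn_integral_has_integral_lebesgue' has_integral_powr_from_0) auto
  also have "(\<integral>\<^sup>+r. ennreal (r powr (- 1 - \<alpha>)) * indicator {1..} r \<partial>lborel)
      = ennreal (- (1 powr (- 1 - \<alpha> + 1)) / (- 1 - \<alpha> + 1))"
    using assms by (intro nn_integral_has_integral_lebesgue' has_integral_powr_to_inf) auto
  finally show ?thesis
    by (rule order.strict_trans1) simp
qed

section \<open>The cosine integral against the radial weight\<close>

text \<open>Half-angle formula: the sine is bounded both by its argument and by 1.\<close>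

lemma one_minus_cos_le: "1 - cos x \<le> 2 * min 1 (x\<^sup>2)" for x :: real
proof -
  have "1 - cos x = 2 * (sin (x / 2))\<^sup>2"
    using cos_double_sin[of "x / 2"] by simp
  moreover have "(sin (x / 2))\<^sup>2 \<le> (x / 2)\<^sup>2"
    using abs_sin_x_le_abs_x[of "x / 2"] by (simp only: abs_le_square_iff)
  moreover have "(x / 2)\<^sup>2 \<le> x\<^sup>2"
    by (simp add: power_divide)
  moreover have "(sin (x / 2))\<^sup>2 \<le> 1"
    by (simp add: abs_square_le_1)
  ultimately show ?thesis
    by (simp add: min_def)
qed

definition cos_constant :: "real \<Rightarrow> ennreal" where
  "cos_constant \<alpha> = (\<integral>\<^sup>+r. radial_density \<alpha> r * ennreal (1 - cos r) \<partial>lborel)"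

lemma cos_constant_finite:
  assumes "0 < \<alpha>" "\<alpha> < 2"
  shows "cos_constant \<alpha> < \<infinity>"
proof -
  have "cos_constant \<alpha>
      \<le> (\<integral>\<^sup>+r. 2 * (radial_density \<alpha> r * ennreal (min 1 (r\<^sup>2))) \<partial>lborel)"
    unfolding cos_constant_def
  proof (intro nn_integral_mono)
    fix r :: real
    have "ennreal (1 - cos r) \<le> ennreal (2 * min 1 (r\<^sup>2))"
      by (intro ennreal_leI one_minus_cos_le)
    also have "\<dots> = 2 * ennreal (min 1 (r\<^sup>2))"
      by (simp add: ennreal_mult)
    finally show "radial_density \<alpha> r * ennreal (1 - cos r)
        \<le> 2 * (radial_density \<alpha> r * ennreal (min 1 (r\<^sup>2)))"
      using mult_left_mono[of _ _ "radial_density \<alpha> r"] by (fastforce simp: ac_simps)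
  qed
  also have "\<dots> < \<infinity>"
    using nn_integral_radial_density_min_finite[OF assms]
    by (simp add: nn_integral_cmult ennreal_mult_less_top)
  finally show ?thesis .
qed

text \<open>An interval of positive length is not a null set. This serves to show that integrals of
  nonnegative functions do not vanish.\<close>

lemma not_AE_lborel_interval:
  assumes "a < (b::real)" and "\<And>x. a < x \<Longrightarrow> x < b \<Longrightarrow> \<not> P x"
  shows "\<not> (AE x in lborel. P x)"
proof
  assume "AE x in lborel. P x"
  then obtain N where N: "{x. \<not> P x} \<subseteq> N" "N \<in> null_sets lborel"
    by (auto elim!: AE_E simp: null_sets_def)
  have "{a<..<b} \<in> null_sets lborel"
    using N assms(2) by (intro null_sets_subset[OF N(2)]) auto
  then show False
    using assms(1) by (simp add: null_sets_def)
qed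

lemma cos_constant_pos: "cos_constant \<alpha> > 0"
proof -
  have "\<not> (AE r in lborel. radial_density \<alpha> r * ennreal (1 - cos r) = 0)"
  proof (rule not_AE_lborel_interval[of 0 pi])
    fix r :: real assume "0 < r" "r < pi"
    then have "cos r < 1"
      using cos_monotone_0_pi[of 0 r] by simp
    then show "\<not> radial_density \<alpha> r * ennreal (1 - cos r) = 0"
      using \<open>0 < r\<close> by (simp add: radial_density_def)
  qed simp
  then have "cos_constant \<alpha> \<noteq> 0"
    unfolding cos_constant_def by (subst nn_integral_0_iff_AE) auto
  then show ?thesis by (simp add: zero_less_iff_neq_zero)
qed

text \<open>Cosine is even, so \<open>a\<close> may be replaced by \<open>\<bar>a\<bar>\<close>,
  whose power the scaling rule pulls out. At \<open>a = 0\<close> both sides vanish, since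
  \<open>0 powr \<alpha> = 0\<close>.\<close>

lemma nn_integral_radial_density_cos:
  "(\<integral>\<^sup>+r. radial_density \<alpha> r * ennreal (1 - cos (r * a)) \<partial>lborel)
   = ennreal (\<bar>a\<bar> powr \<alpha>) * cos_constant \<alpha>"
proof (cases "a = 0")
  case False
  have "cos (\<bar>a\<bar> * r) = cos (r * a)" for r
    by (cases "a \<ge> 0") (simp_all add: mult.commute)
  then show ?thesis
    using nn_integral_radial_density_scale[of "\<lambda>r. ennreal (1 - cos r)" "\<bar>a\<bar>" \<alpha>] False
    by (simp add: cos_constant_def)
qed simp

section \<open>Moments of centred normal laws\<close>

definition normal_moment_powr :: "real \<Rightarrow> ennreal" where
  "normal_moment_powr \<alpha> = (\<integral>\<^sup>+x. ennreal (std_normal_density x) * ennreal (\<bar>x\<bar> powr \<alpha>) \<partial>lborel)"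

text \<open>Reduces moments of order \<alpha> to second moments, both for the normal law and for the
  norm on \<open>E\<close>.\<close>

lemma powr_le_one_plus_square:
  assumes "0 < \<alpha>" "\<alpha> < 2" "0 \<le> (x::real)"
  shows "x powr \<alpha> \<le> 1 + x\<^sup>2"
proof (cases "x \<le> 1")
  case True
  then have "x powr \<alpha> \<le> 1"
    using assms by (simp add: powr_le1)
  then show ?thesis by (simp add: add_increasing2)
next
  case False
  then have "x powr \<alpha> \<le> x powr 2"
    using assms by (intro powr_mono) auto
  then show ?thesis using False by simp
qed

lemma normal_moment_powr_finite:
  assumes "0 < \<alpha>" "\<alpha> < 2"
  shows "normal_moment_powr \<alpha> < \<infinity>"
proof -
  have int: "integrable lborel (\<lambda>x. std_normal_density x + std_normal_density x * x\<^sup>2)"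
    using integrable_std_normal_moment[of 2] by (intro Bochner_Integration.integrable_add) auto
  have "std_normal_density x * \<bar>x\<bar> powr \<alpha> \<le> std_normal_density x + std_normal_density x * x\<^sup>2" for x
    using mult_left_mono[OF powr_le_one_plus_square[OF assms abs_ge_zero, of x], of "std_normal_density x"]
    by (simp add: distrib_left)
  then have "normal_moment_powr \<alpha>
      \<le> (\<integral>\<^sup>+x. ennreal (std_normal_density x + std_normal_density x * x\<^sup>2) \<partial>lborel)"
    unfolding normal_moment_powr_def
    by (intro nn_integral_mono) (simp add: ennreal_mult[symmetric] ennreal_leI del: ennreal_plus)
  also have "\<dots> < \<infinity>"
    using int by (simp add: nn_integral_eq_integral del: ennreal_plus)
  finally show ?thesis .
qed

lemma normal_moment_powr_pos: "normal_moment_powr \<alpha> > 0"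
proof -
  have "\<not> (AE x in lborel. ennreal (std_normal_density x) * ennreal (\<bar>x\<bar> powr \<alpha>) = 0)"
    by (rule not_AE_lborel_interval[of 0 1]) (simp_all add: normal_density_pos[THEN less_imp_neq, THEN not_sym])
  then have "normal_moment_powr \<alpha> \<noteq> 0"
    unfolding normal_moment_powr_def by (subst nn_integral_0_iff_AE) auto
  then show ?thesis by (simp add: zero_less_iff_neq_zero)
qed

text \<open>The substitution \<open>s * x\<close> turns the density with deviation \<open>s\<close>
  into the standard one. The Dirac case agrees because \<open>0 powr \<alpha> = 0\<close>.\<close>

lemma nn_integral_centred_normal_powr:
  assumes "s \<ge> 0"
  shows "(\<integral>\<^sup>+x. ennreal (\<bar>x\<bar> powr \<alpha>) \<partial>centred_normal s) = ennreal (s powr \<alpha>) * normal_moment_powr \<alpha>"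
proof (cases "s = 0")
  case False
  then have s: "s > 0" using assms by simp
  have dens: "s * normal_density 0 s (s * x) = std_normal_density x" for x
    using s by (simp add: normal_density_def power_mult_distrib real_sqrt_mult field_simps)
  have "(\<integral>\<^sup>+x. ennreal (\<bar>x\<bar> powr \<alpha>) \<partial>centred_normal s)
      = (\<integral>\<^sup>+x. ennreal (normal_density 0 s x) * ennreal (\<bar>x\<bar> powr \<alpha>) \<partial>lborel)"
    using False by (simp add: centred_normal_def nn_integral_density)
  also have "\<dots> = ennreal s * (\<integral>\<^sup>+x. ennreal (normal_density 0 s (s * x)) * ennreal (\<bar>s * x\<bar> powr \<alpha>) \<partial>lborel)"
    using s by (subst nn_integral_real_affine[where c=s and t=0]) auto
  also have "\<dots> = (\<integral>\<^sup>+x. ennreal (s powr \<alpha>) * (ennreal (std_normal_density x) * ennreal (\<bar>x\<bar> powr \<alpha>)) \<partial>lborel)"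
    using s by (subst nn_integral_cmult[symmetric])
      (auto intro!: nn_integral_cong simp: ennreal_mult[symmetric] dens[symmetric] abs_mult powr_mult ac_simps)
  also have "\<dots> = ennreal (s powr \<alpha>) * normal_moment_powr \<alpha>"
    by (simp add: normal_moment_powr_def nn_integral_cmult)
  finally show ?thesis .
qed (simp add: centred_normal_def nn_integral_return)

lemma has_bochner_integral_centred_normal_square:
  assumes "s \<ge> 0"
  shows "has_bochner_integral (centred_normal s) (\<lambda>x. x\<^sup>2) (s\<^sup>2)"
proof (cases "s = 0")
  case True
  then show ?thesis
    by (simp add: centred_normal_def has_bochner_integral_iff integrable_iff_bounded
        nn_integral_return integral_return)
next
  case False
  \<comment> \<open>The even moment of index 1 is 2! / (2 / s^2), that is, the variance.\<close>
  then have "has_bochner_integral lborel (\<lambda>x. normal_density 0 s x *\<^sub>R x\<^sup>2) (s\<^sup>2)"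
    using normal_moment_even[of s 0 1] assms by (simp add: fact_numeral)
  then show ?thesis
    using False by (simp add: centred_normal_def has_bochner_integral_density)
qed

subsection \<open>Second moment of the Gaussian measure\<close>

lemma borel_measurable_blinfun_apply [measurable]: "blinfun_apply \<xi> \<in> borel_measurable borel"
  by (intro borel_measurable_continuous_onI linear_continuous_on blinfun.bounded_linear_right)

text \<open>\<open>orthonormal_basis\<close> without density of the span, so that finite families
  qualify.\<close>

definition orthonormal_set :: "'a::real_inner set \<Rightarrow> bool" where
  "orthonormal_set F \<longleftrightarrow> pairwise orthogonal F \<and> (\<forall>f\<in>F. norm f = 1)"

section \<open>Bessel and Parseval estimates for orthonormal sets\<close>

text \<open>Expansion of the square with Pythagoras. Arbitrary coefficients \<open>c\<close> let it
  serve both Bessel's inequality and best approximation.\<close>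

lemma norm_diff_orthonormal_sum:
  assumes "finite F" "orthonormal_set F"
  shows "(norm (x - (\<Sum>f\<in>F. c f *\<^sub>R f)))\<^sup>2 = (norm x)\<^sup>2 - 2 * (\<Sum>f\<in>F. c f * (x \<bullet> f)) + (\<Sum>f\<in>F. (c f)\<^sup>2)"
proof -
  have "(norm (\<Sum>f\<in>F. c f *\<^sub>R f))\<^sup>2 = (\<Sum>f\<in>F. (norm (c f *\<^sub>R f))\<^sup>2)"
    using assms by (intro norm_sum_Pythagorean)
      (auto simp: orthonormal_set_def pairwise_def orthogonal_def)
  also have "\<dots> = (\<Sum>f\<in>F. (c f)\<^sup>2)"
    using assms by (intro sum.cong) (auto simp: orthonormal_set_def)
  finally have "(\<Sum>f\<in>F. c f *\<^sub>R f) \<bullet> (\<Sum>f\<in>F. c f *\<^sub>R f) = (\<Sum>f\<in>F. (c f)\<^sup>2)"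
    by (simp add: power2_norm_eq_inner)
  moreover have "x \<bullet> (\<Sum>f\<in>F. c f *\<^sub>R f) = (\<Sum>f\<in>F. c f * (x \<bullet> f))"
    by (simp add: inner_sum_right)
  ultimately show ?thesis
    by (simp only: power2_norm_eq_inner inner_diff_left inner_diff_right
        inner_commute[of "\<Sum>f\<in>F. c f *\<^sub>R f" x])
qed

lemma bessel_inequality:
  assumes "finite F" "orthonormal_set F"
  shows "(\<Sum>f\<in>F. (x \<bullet> f)\<^sup>2) \<le> (norm x)\<^sup>2"
proof -
  have "0 \<le> (norm (x - (\<Sum>f\<in>F. (x \<bullet> f) *\<^sub>R f)))\<^sup>2" by simp
  then show ?thesis
    unfolding norm_diff_orthonormal_sum[OF assms] by (simp add: power2_eq_square)
qed

text \<open>Completing the square: the squared distance from \<open>x\<close> to \<open>s\<close>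
  exceeds the squared distance to the projection of \<open>x\<close> by the sum of the
  \<open>(c f - x \<bullet> f)\<^sup>2\<close>.\<close>

lemma norm_square_le_orthonormal_sum:
  assumes "finite F" "orthonormal_set F" "s \<in> span F"
  shows "(norm x)\<^sup>2 \<le> (\<Sum>f\<in>F. (x \<bullet> f)\<^sup>2) + (norm (x - s))\<^sup>2"
proof -
  obtain c where s: "s = (\<Sum>f\<in>F. c f *\<^sub>R f)"
    using assms by (auto simp: span_finite)
  have "0 \<le> (\<Sum>f\<in>F. (c f - x \<bullet> f)\<^sup>2)"
    by (simp add: sum_nonneg)
  also have "\<dots> = (\<Sum>f\<in>F. (c f)\<^sup>2) - 2 * (\<Sum>f\<in>F. c f * (x \<bullet> f)) + (\<Sum>f\<in>F. (x \<bullet> f)\<^sup>2)"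
    by (simp add: power2_diff sum.distrib sum_subtractf sum_distrib_left mult.assoc)
  finally show ?thesis
    unfolding s norm_diff_orthonormal_sum[OF assms(1,2)] by simp
qed

text \<open>Bessel bounds the finite partial sums, whence summability. For the estimate,
  \<open>h\<close> is approximated from \<open>span B\<close>; the approximant lies in the span of a
  finite subset, where the projection loses at most \<open>e\<close>.\<close>

lemma orthonormal_basis_parseval:
  assumes "orthonormal_basis B"
  shows "(\<lambda>b. (h \<bullet> b)\<^sup>2) summable_on B" "(norm h)\<^sup>2 \<le> (\<Sum>\<^sub>\<infinity>b\<in>B. (h \<bullet> b)\<^sup>2)"
proof -
  have on: "orthonormal_set F" if "F \<subseteq> B" for F
    using assms that
    by (auto simp: orthonormal_basis_def orthonormal_set_def intro: pairwise_subset)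
  show summable: "(\<lambda>b. (h \<bullet> b)\<^sup>2) summable_on B"
    using on by (intro nonneg_bdd_above_summable_on bdd_aboveI2[where M="(norm h)\<^sup>2"])
      (auto intro!: bessel_inequality)
  show "(norm h)\<^sup>2 \<le> (\<Sum>\<^sub>\<infinity>b\<in>B. (h \<bullet> b)\<^sup>2)"
  proof (rule field_le_epsilon)
    fix e :: real assume "e > 0"
    moreover have "h \<in> closure (span B)"
      using assms by (simp add: orthonormal_basis_def)
    ultimately obtain s where s: "s \<in> span B" "dist s h < sqrt e"
      by (metis closure_approachable real_sqrt_gt_zero)
    obtain F where F: "finite F" "F \<subseteq> B" "s \<in> span F"
      using s(1) by (smt (verit) span_explicit mem_Collect_eq span_base span_scale span_sum)
    have "(norm (h - s))\<^sup>2 \<le> (sqrt e)\<^sup>2"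
      using s(2) by (intro power_mono) (auto simp: dist_norm norm_minus_commute)
    then have "(norm h)\<^sup>2 \<le> (\<Sum>f\<in>F. (h \<bullet> f)\<^sup>2) + e"
      using norm_square_le_orthonormal_sum[OF F(1) on[OF F(2)] F(3), of h] \<open>e > 0\<close> by simp
    also have "(\<Sum>f\<in>F. (h \<bullet> f)\<^sup>2) \<le> (\<Sum>\<^sub>\<infinity>b\<in>B. (h \<bullet> b)\<^sup>2)"
      using summable F by (intro finite_sum_le_infsum) auto
    finally show "(norm h)\<^sup>2 \<le> (\<Sum>\<^sub>\<infinity>b\<in>B. (h \<bullet> b)\<^sup>2) + e" by simp
  qed
qed

text \<open>Orthogonalise, discard the zero vector, which an orthogonal set may contain, and
  normalise.\<close>

lemma finite_orthonormal_spanning_set: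
  fixes A :: "'a::real_inner set"
  assumes "finite A"
  obtains F where "finite F" "orthonormal_set F" "A \<subseteq> span F"
proof -
  obtain C where C: "finite C" "span C = span A" "pairwise orthogonal C"
    using basis_orthogonal[OF assms] by blast
  define F where "F = (\<lambda>c. c /\<^sub>R norm c) ` (C - {0})"
  have "orthonormal_set F"
    using C(3) by (auto simp: F_def orthonormal_set_def pairwise_def orthogonal_def)
  moreover have "c \<in> span F" if "c \<in> C" for c
  proof (cases "c = 0")
    case False
    then have "norm c *\<^sub>R (c /\<^sub>R norm c) \<in> span F"
      using that by (intro span_scale span_base) (auto simp: F_def)
    then show ?thesis using False by simp
  qed (simp add: span_zero)
  then have "span A \<subseteq> span F"
    using C(2) by (metis span_minimal subsetI subspace_span)
  then have "A \<subseteq> span F"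
    using span_superset by blast
  moreover have "finite F"
    using C(1) by (simp add: F_def)
  ultimately show ?thesis using that by blast
qed

text \<open>The sets \<open>F n\<close> span longer and longer pieces of a dense sequence, so the
  squared projections of \<open>x\<close> eventually exceed \<open>(norm x)\<^sup>2 - e\<close>.
  Fatou's lemma carries the uniform bound to the limit.\<close>

lemma nn_integral_norm_square_le:
  fixes \<mu> :: "'e::{real_inner, second_countable_topology} measure"
  assumes [measurable_cong]: "sets \<mu> = sets borel"
    and bound: "\<And>F. finite F \<Longrightarrow> orthonormal_set F
      \<Longrightarrow> (\<integral>\<^sup>+x. ennreal (\<Sum>f\<in>F. (x \<bullet> f)\<^sup>2) \<partial>\<mu>) \<le> M"
  shows "(\<integral>\<^sup>+x. ennreal ((norm x)\<^sup>2) \<partial>\<mu>) \<le> M"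
proof -
  obtain D :: "'e set" where D: "countable D"
      "\<And>X. open X \<Longrightarrow> X \<noteq> {} \<Longrightarrow> \<exists>d\<in>D. d \<in> X"
    using countable_dense_setE by blast
  define d where "d = from_nat_into D"
  have "\<exists>F. finite F \<and> orthonormal_set F \<and> d ` {..n} \<subseteq> span F" for n
    using finite_orthonormal_spanning_set[of "d ` {..n}"] by blast
  then obtain F where F: "\<And>n. finite (F n)" "\<And>n. orthonormal_set (F n)"
      "\<And>n. d ` {..n} \<subseteq> span (F n)"
    by metis
  define u where "u n = (\<lambda>x. ennreal (\<Sum>f\<in>F n. (x \<bullet> f)\<^sup>2))" for n
  have [measurable]: "u n \<in> borel_measurable borel" for n
    unfolding u_def by measurable
  \<comment> \<open>The \<open>F n\<close> are chosen separately and their spans need not be nested,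
    hence a lower limit rather than monotone convergence.\<close>
  have "ennreal ((norm x)\<^sup>2) \<le> liminf (\<lambda>n. u n x)" for x
  proof (rule ennreal_le_epsilon)
    fix e :: real assume "e > 0"
    then obtain y where y: "y \<in> D" "dist x y < sqrt e"
      using D(2)[of "ball x (sqrt e)"] by auto
    then obtain k where k: "y = d k"
      using D(1) from_nat_into_surj unfolding d_def by metis
    have "(norm (x - y))\<^sup>2 \<le> (sqrt e)\<^sup>2"
      using y(2) by (intro power_mono) (auto simp: dist_norm)
    then have e: "(norm (x - y))\<^sup>2 \<le> e" using \<open>e > 0\<close> by simp
    have "ennreal ((norm x)\<^sup>2 - e) \<le> u n x" if "n \<ge> k" for n
    proof -
      have "y \<in> span (F n)" using F(3)[of n] that k by auto
      then show ?thesis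
        using norm_square_le_orthonormal_sum[OF F(1,2), of y n x] e
        unfolding u_def by (intro ennreal_leI) simp
    qed
    then have "ennreal ((norm x)\<^sup>2 - e) \<le> liminf (\<lambda>n. u n x)"
      by (intro Liminf_bounded) (auto simp: eventually_sequentially)
    then have "ennreal ((norm x)\<^sup>2 - e) + ennreal e \<le> liminf (\<lambda>n. u n x) + ennreal e"
      by (rule add_right_mono)
    \<comment> \<open>\<open>ennreal\<close> truncates negative numbers to 0, so for large
      \<open>e\<close> this is a strict inequality.\<close>
    moreover have "ennreal ((norm x)\<^sup>2) \<le> ennreal ((norm x)\<^sup>2 - e) + ennreal e"
      using \<open>e > 0\<close> by (cases "(norm x)\<^sup>2 \<ge> e")
        (auto simp: ennreal_plus[symmetric] ennreal_neg simp del: ennreal_plus intro: ennreal_leI)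
    ultimately show "ennreal ((norm x)\<^sup>2) \<le> liminf (\<lambda>n. u n x) + ennreal e"
      by (rule order.trans[rotated])
  qed
  then have "(\<integral>\<^sup>+x. ennreal ((norm x)\<^sup>2) \<partial>\<mu>) \<le> (\<integral>\<^sup>+x. liminf (\<lambda>n. u n x) \<partial>\<mu>)"
    by (intro nn_integral_mono) simp
  also have "\<dots> \<le> liminf (\<lambda>n. integral\<^sup>N \<mu> (u n))"
    by (rule nn_integral_liminf) measurable
  also have "\<dots> \<le> liminf (\<lambda>n. M)"
    using bound[OF F(1,2)] by (intro Liminf_mono) (simp add: u_def)
  finally show ?thesis by (simp add: Liminf_const)
qed

section \<open>Laws of functionals, the covariance operator as an adjoint, and the second
  moment\<close>

context abstract_wiener_space
begin

interpretation \<mu>: prob_space \<mu>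
  using gaussian by (simp add: centred_gaussian_measure_def)

lemma sets_\<mu> [measurable_cong]: "sets \<mu> = sets borel"
  using gaussian by (simp add: centred_gaussian_measure_def)

lemma embedding_covariance_in: "\<iota> (covariance_in \<iota> \<mu> \<xi>) = covariance_operator \<mu> \<xi>"
  unfolding covariance_in_def using covariance_range by (intro f_inv_into_f) auto

text \<open>The unknown deviation \<open>s\<close> is identified by computing the second moment
  twice: from the scalar product of \<open>H\<close> and from the normal law.\<close>

lemma distr_dual:
  "distr \<mu> borel (blinfun_apply \<xi>) = centred_normal (norm (covariance_in \<iota> \<mu> \<xi>))"
proof -
  obtain s where s: "s \<ge> 0" "distr \<mu> borel (blinfun_apply \<xi>) = centred_normal s"
    using gaussian by (auto simp: centred_gaussian_measure_def)
  have "(norm (covariance_in \<iota> \<mu> \<xi>))\<^sup>2 = (\<integral>x. (blinfun_apply \<xi> x)\<^sup>2 \<partial>\<mu>)"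
    using covariance_inner[of \<xi> \<xi>] by (simp add: power2_norm_eq_inner power2_eq_square[of "blinfun_apply _ _"])
  also have "\<dots> = (\<integral>x. x\<^sup>2 \<partial>distr \<mu> borel (blinfun_apply \<xi>))"
    by (subst integral_distr) simp_all
  also have "\<dots> = s\<^sup>2"
    unfolding s(2) using has_bochner_integral_centred_normal_square[OF s(1)]
    by (rule has_bochner_integral_integral_eq)
  finally show ?thesis
    using s by simp
qed

text \<open>\<open>covariance_inner\<close> fixes only the value of a Bochner integral; the law of
  \<xi> also yields integrability.\<close>

lemma has_bochner_integral_dual_square:
  "has_bochner_integral \<mu> (\<lambda>x. (blinfun_apply \<xi> x)\<^sup>2) ((norm (covariance_in \<iota> \<mu> \<xi>))\<^sup>2)"
proof -
  have "has_bochner_integral (distr \<mu> borel (blinfun_apply \<xi>)) (\<lambda>x. x\<^sup>2)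
      ((norm (covariance_in \<iota> \<mu> \<xi>))\<^sup>2)"
    unfolding distr_dual by (rule has_bochner_integral_centred_normal_square) simp
  then show ?thesis
    using integrable_distr_eq[of "blinfun_apply \<xi>" \<mu> borel "\<lambda>x. x\<^sup>2"]
      integral_distr[of "blinfun_apply \<xi>" \<mu> borel "\<lambda>x. x\<^sup>2"]
    by (simp add: has_bochner_integral_iff)
qed

text \<open>If the integrand were not integrable, the covariance would be the junk value \<open>0\<close> of the
  Bochner integral, hence \<open>\<xi> = 0\<close> almost everywhere, and the integrand would be null.\<close>

lemma integrable_covariance: "integrable \<mu> (\<lambda>x. blinfun_apply \<xi> x *\<^sub>R x)"
proof (rule ccontr)
  assume not_int: "\<not> integrable \<mu> (\<lambda>x. blinfun_apply \<xi> x *\<^sub>R x)"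
  then have "\<iota> (covariance_in \<iota> \<mu> \<xi>) = \<iota> 0"
    using bounded_linear.linear[OF embedding_bounded_linear, THEN linear_0]
    by (simp add: embedding_covariance_in covariance_operator_def not_integrable_integral_eq)
  then have "covariance_in \<iota> \<mu> \<xi> = 0"
    using embedding_inj by (simp add: inj_eq)
  then have "AE x in \<mu>. (blinfun_apply \<xi> x)\<^sup>2 = 0"
    using has_bochner_integral_dual_square[of \<xi>]
    by (subst integral_nonneg_eq_0_iff_AE[symmetric]) (auto simp: has_bochner_integral_iff)
  then have "AE x in \<mu>. blinfun_apply \<xi> x *\<^sub>R x = 0"
    by eventually_elim simp
  then have "integrable \<mu> (\<lambda>x. blinfun_apply \<xi> x *\<^sub>R x)"
    by (subst integrable_cong_AE[where g="\<lambda>_. 0"]) auto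
  then show False using not_int by simp
qed

text \<open>For \<open>h\<close> in the range of the covariance, \<xi> is moved through the Bochner
  integral, which integrability permits. Both sides are continuous in \<open>h\<close> and that
  range is dense.\<close>

lemma covariance_in_adjoint: "h \<bullet> covariance_in \<iota> \<mu> \<xi> = blinfun_apply \<xi> (\<iota> h)"
proof -
  have "covariance_in \<iota> \<mu> \<eta> \<bullet> covariance_in \<iota> \<mu> \<xi> = blinfun_apply \<xi> (\<iota> (covariance_in \<iota> \<mu> \<eta>))" for \<eta>
  proof -
    have "blinfun_apply \<xi> (covariance_operator \<mu> \<eta>)
        = (\<integral>x. blinfun_apply \<xi> (blinfun_apply \<eta> x *\<^sub>R x) \<partial>\<mu>)"
      unfolding covariance_operator_def
      by (rule integral_bounded_linear[OF blinfun.bounded_linear_right integrable_covariance, symmetric])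
    then show ?thesis
      by (simp add: covariance_inner embedding_covariance_in blinfun.scaleR_right)
  qed
  moreover have "closed {h. h \<bullet> covariance_in \<iota> \<mu> \<xi> = blinfun_apply \<xi> (\<iota> h)}"
    by (intro closed_Collect_eq continuous_intros
        linear_continuous_on embedding_bounded_linear)
  ultimately have "closure (range (covariance_in \<iota> \<mu>)) \<subseteq> {h. h \<bullet> covariance_in \<iota> \<mu> \<xi> = blinfun_apply \<xi> (\<iota> h)}"
    by (intro closure_minimal) auto
  then show ?thesis
    using covariance_dense by auto
qed

lemma nn_integral_dual_powr:
  "(\<integral>\<^sup>+x. ennreal (\<bar>blinfun_apply \<xi> x\<bar> powr \<alpha>) \<partial>\<mu>)
    = ennreal (norm (covariance_in \<iota> \<mu> \<xi>) powr \<alpha>) * normal_moment_powr \<alpha>"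
proof -
  have "(\<integral>\<^sup>+x. ennreal (\<bar>blinfun_apply \<xi> x\<bar> powr \<alpha>) \<partial>\<mu>)
      = (\<integral>\<^sup>+t. ennreal (\<bar>t\<bar> powr \<alpha>) \<partial>distr \<mu> borel (blinfun_apply \<xi>))"
    by (simp add: nn_integral_distr)
  then show ?thesis
    by (simp add: distr_dual nn_integral_centred_normal_powr)
qed

text \<open>The set \<open>{0}\<close> is closed, so it cannot contain a dense subset of
  \<open>H\<close>. This gives non-triviality of the final measure.\<close>

lemma exists_covariance_in_nonzero:
  assumes "(UNIV :: 'h set) \<noteq> {0}"
  shows "\<exists>\<xi>. covariance_in \<iota> \<mu> \<xi> \<noteq> 0"
proof (rule ccontr)
  assume "\<not> ?thesis"
  then have "range (covariance_in \<iota> \<mu>) \<subseteq> {0}" by auto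
  then have "closure (range (covariance_in \<iota> \<mu>)) \<subseteq> {0}"
    by (intro closure_minimal) auto
  then show False using covariance_dense assms by auto
qed

end

lemma has_sum_sum:
  fixes g :: "'i \<Rightarrow> 'a \<Rightarrow> 'b::topological_comm_monoid_add"
  assumes "finite I" "\<And>i. i \<in> I \<Longrightarrow> (g i has_sum s i) A"
  shows "((\<lambda>x. \<Sum>i\<in>I. g i x) has_sum (\<Sum>i\<in>I. s i)) A"
  using assms by (induction I rule: finite_induct) (auto intro!: has_sum_add has_sum_0)

text \<open>For finite orthonormal \<open>F\<close> in \<open>E\<close>, the integral of the squared
  projections is the sum of the \<open>(norm (S f))\<^sup>2\<close>. Expanding along
  \<open>B\<close> and using the adjoint relation compares it with the Hilbert-Schmidt sum,
  uniformly in \<open>F\<close>.\<close>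

lemma wiener_norm_square_finite:
  fixes \<iota> :: "'h::{real_inner, banach, second_countable_topology}
                \<Rightarrow> 'e::{real_inner, banach, second_countable_topology}"
  assumes "abstract_wiener_space \<iota> \<mu>" "hilbert_schmidt \<iota>"
  shows "(\<integral>\<^sup>+x. ennreal ((norm x)\<^sup>2) \<partial>\<mu>) < \<infinity>"
proof -
  interpret abstract_wiener_space \<iota> \<mu> by fact
  obtain B where B: "orthonormal_basis B" "(\<lambda>b. (norm (\<iota> b))\<^sup>2) summable_on B"
    using assms(2) by (auto simp: hilbert_schmidt_def)
  \<comment> \<open>The covariance operator after the Riesz identification of \<open>f\<close> with
    the functional it represents.\<close>
  define S where "S f = covariance_in \<iota> \<mu> (blinfun_inner_left f)" for f
  have S: "S f \<bullet> b = \<iota> b \<bullet> f" for f b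
    using covariance_in_adjoint[of b "blinfun_inner_left f"] by (simp add: S_def inner_commute)
  have bound: "(\<integral>\<^sup>+x. ennreal (\<Sum>f\<in>F. (x \<bullet> f)\<^sup>2) \<partial>\<mu>) \<le> ennreal (\<Sum>\<^sub>\<infinity>b\<in>B. (norm (\<iota> b))\<^sup>2)"
    if F: "finite F" "orthonormal_set F" for F
  proof -
    have "has_bochner_integral \<mu> (\<lambda>x. \<Sum>f\<in>F. (x \<bullet> f)\<^sup>2) (\<Sum>f\<in>F. (norm (S f))\<^sup>2)"
      using has_bochner_integral_dual_square[of "blinfun_inner_left f" for f]
      by (intro has_bochner_integral_sum) (simp add: S_def)
    then have "(\<integral>\<^sup>+x. ennreal (\<Sum>f\<in>F. (x \<bullet> f)\<^sup>2) \<partial>\<mu>) = ennreal (\<Sum>f\<in>F. (norm (S f))\<^sup>2)"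
      by (subst nn_integral_eq_integral) (auto simp: has_bochner_integral_iff sum_nonneg)
    also have "(\<Sum>f\<in>F. (norm (S f))\<^sup>2) \<le> (\<Sum>f\<in>F. \<Sum>\<^sub>\<infinity>b\<in>B. (S f \<bullet> b)\<^sup>2)"
      by (intro sum_mono orthonormal_basis_parseval B)
    also have "\<dots> \<le> (\<Sum>\<^sub>\<infinity>b\<in>B. (norm (\<iota> b))\<^sup>2)"
    proof (rule has_sum_mono)
      show "((\<lambda>b. \<Sum>f\<in>F. (S f \<bullet> b)\<^sup>2) has_sum (\<Sum>f\<in>F. \<Sum>\<^sub>\<infinity>b\<in>B. (S f \<bullet> b)\<^sup>2)) B"
        by (intro has_sum_sum has_sum_infsum orthonormal_basis_parseval B F)
      show "((\<lambda>b. (norm (\<iota> b))\<^sup>2) has_sum (\<Sum>\<^sub>\<infinity>b\<in>B. (norm (\<iota> b))\<^sup>2)) B"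
        using B(2) by (rule has_sum_infsum)
    \<comment> \<open>For each \<open>b\<close>, the adjoint relation makes the term a sum of
      \<open>(\<iota> b \<bullet> f)\<^sup>2\<close>, to which Bessel's inequality in
      \<open>E\<close> applies.\<close>
    qed (simp add: S bessel_inequality F)
    finally show ?thesis by (simp add: ennreal_leI)
  qed
  have "(\<integral>\<^sup>+x. ennreal ((norm x)\<^sup>2) \<partial>\<mu>) \<le> ennreal (\<Sum>\<^sub>\<infinity>b\<in>B. (norm (\<iota> b))\<^sup>2)"
    by (rule nn_integral_norm_square_le[OF sets_\<mu> bound])
  then show ?thesis
    by (simp add: order.strict_trans1)
qed

subsection \<open>Radial measures\<close>

text \<open>Defined as an image measure, so that countable additivity is automatic; the iterated
  integral is then derived.\<close>

definition radial_measure ::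
    "real \<Rightarrow> 'e::{real_normed_vector, second_countable_topology} measure \<Rightarrow> 'e measure" where
  "radial_measure \<alpha> \<sigma> = distr (density lborel (radial_density \<alpha>) \<Otimes>\<^sub>M \<sigma>) borel (\<lambda>(r, y). r *\<^sub>R y)"

lemma sets_radial_measure [measurable_cong]: "sets (radial_measure \<alpha> \<sigma>) = sets borel"
  by (simp add: radial_measure_def)

context
  fixes \<sigma> :: "'e::{real_normed_vector, second_countable_topology} measure"
  assumes fin: "finite_measure \<sigma>"
    and sets_\<sigma>: "sets \<sigma> = sets (restrict_space borel (sphere (0::'e) 1))"
begin

interpretation \<sigma>: finite_measure \<sigma> by (rule fin)

lemma space_sphere_measure: "space \<sigma> = sphere 0 1"
  using sets_eq_imp_space_eq[OF sets_\<sigma>] by (simp add: space_restrict_space)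

lemma measurable_id_sphere_measure: "(\<lambda>y. y) \<in> \<sigma> \<rightarrow>\<^sub>M borel"
  unfolding measurable_cong_sets[OF sets_\<sigma> refl] by (rule measurable_restrict_space1) simp

lemma measurable_scaleR_sphere_measure:
  assumes "sets N = sets borel"
  shows "(\<lambda>z. fst z *\<^sub>R snd z) \<in> N \<Otimes>\<^sub>M \<sigma> \<rightarrow>\<^sub>M borel"
  using measurable_compose[OF measurable_fst measurable_ident_sets[OF assms]]
    measurable_compose[OF measurable_snd measurable_id_sphere_measure]
  by (rule borel_measurable_scaleR)

text \<open>Change of variables followed by Tonelli, for which finiteness of \<sigma> supplies
  sigma-finiteness.\<close>

lemma nn_integral_radial_measure:
  assumes [measurable]: "f \<in> borel_measurable borel"
  shows "(\<integral>\<^sup>+x. f x \<partial>radial_measure \<alpha> \<sigma>)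
       = (\<integral>\<^sup>+r. radial_density \<alpha> r * (\<integral>\<^sup>+y. f (r *\<^sub>R y) \<partial>\<sigma>) \<partial>lborel)"
proof -
  note [measurable] = measurable_id_sphere_measure
    measurable_scaleR_sphere_measure[of "density lborel (radial_density \<alpha>)"]
    measurable_scaleR_sphere_measure[of borel]
  have "(\<integral>\<^sup>+x. f x \<partial>radial_measure \<alpha> \<sigma>)
      = (\<integral>\<^sup>+z. f (fst z *\<^sub>R snd z) \<partial>(density lborel (radial_density \<alpha>) \<Otimes>\<^sub>M \<sigma>))"
    unfolding radial_measure_def split_beta by (subst nn_integral_distr) simp_all
  also have "\<dots> = (\<integral>\<^sup>+r. \<integral>\<^sup>+y. f (r *\<^sub>R y) \<partial>\<sigma> \<partial>density lborel (radial_density \<alpha>))"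
    by (subst \<sigma>.nn_integral_fst[symmetric]) simp_all
  also have "\<dots> = (\<integral>\<^sup>+r. radial_density \<alpha> r * (\<integral>\<^sup>+y. f (r *\<^sub>R y) \<partial>\<sigma>) \<partial>lborel)"
    by (intro nn_integral_density) measurable
  finally show ?thesis .
qed

lemma emeasure_radial_measure:
  assumes "B \<in> sets borel"
  shows "emeasure (radial_measure \<alpha> \<sigma>) B
       = (\<integral>\<^sup>+r\<in>{0<..}. ennreal (1 / r powr (1 + \<alpha>)) * (\<integral>\<^sup>+y. indicator B (r *\<^sub>R y) \<partial>\<sigma>) \<partial>lborel)"
  using assms nn_integral_radial_measure[of "indicator B" \<alpha>]
  by (simp add: sets_radial_measure radial_density_def ac_simps)

text \<open>On the sphere \<open>norm (r *\<^sub>R y)\<close> is \<open>\<bar>r\<bar>\<close>, so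
  the integral factors into a radial integral and the mass of \<sigma>. The origin is not hit for
  \<open>r > 0\<close>.\<close>

lemma levy_measure_radial_measure:
  assumes "0 < \<alpha>" "\<alpha> < 2"
  shows "levy_measure (radial_measure \<alpha> \<sigma>)"
  unfolding levy_measure_def
proof (intro conjI)
  note [measurable] = measurable_id_sphere_measure
  have "(\<integral>\<^sup>+y. indicator {0} (r *\<^sub>R y) \<partial>\<sigma>) = 0" if "r > 0" for r
    using that by (subst nn_integral_0_iff_AE)
      (auto simp: indicator_def space_sphere_measure intro!: AE_I2)
  then have "ennreal (1 / r powr (1 + \<alpha>)) * (\<integral>\<^sup>+y. indicator {0} (r *\<^sub>R y) \<partial>\<sigma>) * indicator {0<..} r = 0" for r
    by (cases "r > 0") auto
  then show "emeasure (radial_measure \<alpha> \<sigma>) {0} = 0"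
    by (subst emeasure_radial_measure) (simp_all only: borel_singleton sets.empty_sets nn_integral_const mult_zero_left)
  have "(\<integral>\<^sup>+y. ennreal (min 1 ((norm (r *\<^sub>R y))\<^sup>2)) \<partial>\<sigma>) = (\<integral>\<^sup>+y. ennreal (min 1 (r\<^sup>2)) \<partial>\<sigma>)" for r
    by (intro nn_integral_cong) (simp add: space_sphere_measure)
  then have "(\<integral>\<^sup>+x. ennreal (min 1 ((norm x)\<^sup>2)) \<partial>radial_measure \<alpha> \<sigma>)
      = (\<integral>\<^sup>+r. radial_density \<alpha> r * ennreal (min 1 (r\<^sup>2)) * emeasure \<sigma> (space \<sigma>) \<partial>lborel)"
    by (simp add: nn_integral_radial_measure mult.assoc)
  also have "\<dots> = (\<integral>\<^sup>+r. radial_density \<alpha> r * ennreal (min 1 (r\<^sup>2)) \<partial>lborel) * emeasure \<sigma> (space \<sigma>)"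
    by (rule nn_integral_multc) measurable
  also have "\<dots> < \<infinity>"
    using nn_integral_radial_density_min_finite[OF assms] \<sigma>.emeasure_finite[of "space \<sigma>"]
    by (auto simp: ennreal_mult_eq_top_iff less_top[symmetric])
  finally show "(\<integral>\<^sup>+x. ennreal (min 1 ((norm x)\<^sup>2)) \<partial>radial_measure \<alpha> \<sigma>) < \<infinity>" .
qed (rule sets_radial_measure)

end

section \<open>The spherical measure built from the Gaussian measure\<close>

text \<open>The vector \<open>e\<close> is a placeholder that keeps the map inside the sphere at the
  origin. The density vanishes there, so its choice has no effect.\<close>

definition spherical_moment_measure ::
    "'e::{real_normed_vector, second_countable_topology} \<Rightarrow> real \<Rightarrow> real \<Rightarrow> 'e measure \<Rightarrow> 'e measure" where
  "spherical_moment_measure e c \<alpha> \<mu> =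
     distr (density \<mu> (\<lambda>x. ennreal (c * norm x powr \<alpha>))) (restrict_space borel (sphere 0 1))
       (\<lambda>x. if x = 0 then e else x /\<^sub>R norm x)"

lemma sets_spherical_moment_measure:
  "sets (spherical_moment_measure e c \<alpha> \<mu>) = sets (restrict_space borel (sphere 0 1))"
  by (simp add: spherical_moment_measure_def)

lemma nn_integral_spherical_moment_measure:
  fixes \<mu> :: "'e::{real_normed_vector, second_countable_topology} measure"
  assumes [measurable_cong]: "sets \<mu> = sets borel" and e: "norm e = 1"
    and [measurable]: "g \<in> borel_measurable borel"
  shows "(\<integral>\<^sup>+y. g y \<partial>spherical_moment_measure e c \<alpha> \<mu>)
       = (\<integral>\<^sup>+x. ennreal (c * norm x powr \<alpha>) * g (if x = 0 then e else x /\<^sub>R norm x) \<partial>\<mu>)"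
proof -
  have [measurable]: "(\<lambda>x. if x = 0 then e else x /\<^sub>R norm x)
      \<in> density \<mu> (\<lambda>x. ennreal (c * norm x powr \<alpha>)) \<rightarrow>\<^sub>M restrict_space borel (sphere 0 1)"
    using e by (intro measurable_restrict_space2) (auto simp: space_restrict_space)
  have [measurable]: "g \<in> borel_measurable (restrict_space borel (sphere 0 1))"
    by (rule measurable_restrict_space1) measurable
  have "(\<integral>\<^sup>+y. g y \<partial>spherical_moment_measure e c \<alpha> \<mu>)
      = (\<integral>\<^sup>+x. g (if x = 0 then e else x /\<^sub>R norm x) \<partial>density \<mu> (\<lambda>x. ennreal (c * norm x powr \<alpha>)))"
    unfolding spherical_moment_measure_def by (intro nn_integral_distr) measurable
  also have "\<dots> = (\<integral>\<^sup>+x. ennreal (c * norm x powr \<alpha>) * g (if x = 0 then e else x /\<^sub>R norm x) \<partial>\<mu>)"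
    by (intro nn_integral_density) measurable
  finally show ?thesis .
qed

text \<open>The total mass is \<open>c\<close> times the moment of order \<alpha> of the norm, which
  is controlled by the second moment.\<close>

lemma finite_spherical_moment_measure:
  fixes \<mu> :: "'e::{real_normed_vector, second_countable_topology} measure"
  assumes [measurable_cong]: "sets \<mu> = sets borel" and e: "norm e = 1" and c: "c \<ge> 0"
    and "prob_space \<mu>" and \<alpha>: "0 < \<alpha>" "\<alpha> < 2"
    and fin: "(\<integral>\<^sup>+x. ennreal ((norm x)\<^sup>2) \<partial>\<mu>) < \<infinity>"
  shows "finite_measure (spherical_moment_measure e c \<alpha> \<mu>)"
proof (rule finite_measureI)
  interpret prob_space \<mu> by fact
  let ?S = "spherical_moment_measure e c \<alpha> \<mu>"
  have "emeasure ?S (space ?S) = (\<integral>\<^sup>+x. ennreal (c * norm x powr \<alpha>) \<partial>\<mu>)"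
    using nn_integral_spherical_moment_measure[OF assms(1) e, of "\<lambda>_. 1"] by simp
  also have "\<dots> \<le> (\<integral>\<^sup>+x. ennreal c * (1 + ennreal ((norm x)\<^sup>2)) \<partial>\<mu>)"
  proof (intro nn_integral_mono)
    fix x :: 'e
    have "ennreal (c * norm x powr \<alpha>) \<le> ennreal (c * (1 + (norm x)\<^sup>2))"
      using powr_le_one_plus_square[OF \<alpha>, of "norm x"] c
      by (intro ennreal_leI mult_left_mono) auto
    then show "ennreal (c * norm x powr \<alpha>) \<le> ennreal c * (1 + ennreal ((norm x)\<^sup>2))"
      using c by (simp add: ennreal_mult)
  qed
  also have "\<dots> = ennreal c * (1 + (\<integral>\<^sup>+x. ennreal ((norm x)\<^sup>2) \<partial>\<mu>))"
    by (simp add: nn_integral_cmult nn_integral_add emeasure_space_1)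
  also have "\<dots> < \<infinity>"
    using fin by (simp add: ennreal_mult_less_top)
  finally show "emeasure ?S (space ?S) \<noteq> \<infinity>" by simp
qed

text \<open>Tonelli brings the radial integral inside, where it gives the power of
  \<open>\<bar>\<xi> (u x)\<bar>\<close>; the weight \<open>norm x powr \<alpha>\<close> restores
  \<open>\<bar>\<xi> x\<bar>\<close>.\<close>

lemma nn_integral_radial_spherical_cos:
  fixes \<mu> :: "'e::{real_normed_vector, second_countable_topology} measure"
    and \<xi> :: "'e \<Rightarrow>\<^sub>L real"
  assumes [measurable_cong]: "sets \<mu> = sets borel" and e: "norm e = 1" and c: "c \<ge> 0"
    and "prob_space \<mu>" and fin: "finite_measure (spherical_moment_measure e c \<alpha> \<mu>)"
  shows "(\<integral>\<^sup>+x. ennreal (1 - cos (blinfun_apply \<xi> x))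
        \<partial>radial_measure \<alpha> (spherical_moment_measure e c \<alpha> \<mu>))
      = ennreal c * cos_constant \<alpha> * (\<integral>\<^sup>+x. ennreal (\<bar>blinfun_apply \<xi> x\<bar> powr \<alpha>) \<partial>\<mu>)"
proof -
  interpret prob_space \<mu> by fact
  interpret P: pair_sigma_finite lborel \<mu> ..
  define u where "u x = (if x = 0 then e else x /\<^sub>R norm x)" for x :: 'e
  have [measurable]: "u \<in> borel_measurable borel"
    unfolding u_def by measurable
  \<comment> \<open>At \<open>x = 0\<close> both sides are 0, whatever the value of
    \<open>u\<close>.\<close>
  have scale: "c * norm x powr \<alpha> * \<bar>blinfun_apply \<xi> (u x)\<bar> powr \<alpha> = c * \<bar>blinfun_apply \<xi> x\<bar> powr \<alpha>" for x
    by (cases "x = 0")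
      (auto simp: u_def blinfun.scaleR_right abs_mult powr_mult[symmetric] field_simps)
  have "(\<integral>\<^sup>+x. ennreal (1 - cos (blinfun_apply \<xi> x))
        \<partial>radial_measure \<alpha> (spherical_moment_measure e c \<alpha> \<mu>))
      = (\<integral>\<^sup>+r. radial_density \<alpha> r * (\<integral>\<^sup>+x. ennreal (c * norm x powr \<alpha>) *
          ennreal (1 - cos (r * blinfun_apply \<xi> (u x))) \<partial>\<mu>) \<partial>lborel)"
    by (subst nn_integral_radial_measure[OF fin sets_spherical_moment_measure])
      (simp_all add: nn_integral_spherical_moment_measure[OF assms(1) e] blinfun.scaleR_right u_def)
  also have "\<dots> = (\<integral>\<^sup>+r. \<integral>\<^sup>+x. radial_density \<alpha> r * (ennreal (c * norm x powr \<alpha>) *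
          ennreal (1 - cos (r * blinfun_apply \<xi> (u x)))) \<partial>\<mu> \<partial>lborel)"
    by (subst nn_integral_cmult) simp_all
  also have "\<dots> = (\<integral>\<^sup>+x. \<integral>\<^sup>+r. radial_density \<alpha> r * (ennreal (c * norm x powr \<alpha>) *
          ennreal (1 - cos (r * blinfun_apply \<xi> (u x)))) \<partial>lborel \<partial>\<mu>)"
    by (rule P.Fubini'[symmetric]) simp
  also have "\<dots> = (\<integral>\<^sup>+x. ennreal (c * norm x powr \<alpha>) * (\<integral>\<^sup>+r. radial_density \<alpha> r *
          ennreal (1 - cos (r * blinfun_apply \<xi> (u x))) \<partial>lborel) \<partial>\<mu>)"
    by (subst nn_integral_cmult[symmetric]) (simp_all add: mult.left_commute)
  also have "\<dots> = (\<integral>\<^sup>+x. ennreal c * cos_constant \<alpha> * ennreal (\<bar>blinfun_apply \<xi> x\<bar> powr \<alpha>) \<partial>\<mu>)"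
  proof (intro nn_integral_cong)
    fix x
    have "ennreal (c * norm x powr \<alpha>) * ennreal (\<bar>blinfun_apply \<xi> (u x)\<bar> powr \<alpha>)
        = ennreal c * ennreal (\<bar>blinfun_apply \<xi> x\<bar> powr \<alpha>)"
      using c by (simp add: ennreal_mult[symmetric] scale)
    then show "ennreal (c * norm x powr \<alpha>) * (\<integral>\<^sup>+r. radial_density \<alpha> r *
          ennreal (1 - cos (r * blinfun_apply \<xi> (u x))) \<partial>lborel)
        = ennreal c * cos_constant \<alpha> * ennreal (\<bar>blinfun_apply \<xi> x\<bar> powr \<alpha>)"
      unfolding nn_integral_radial_density_cos by (simp add: mult.assoc[symmetric] mult.commute[of "cos_constant \<alpha>"])
        (simp add: ac_simps)
  qed
  also have "\<dots> = ennreal c * cos_constant \<alpha> * (\<integral>\<^sup>+x. ennreal (\<bar>blinfun_apply \<xi> x\<bar> powr \<alpha>) \<partial>\<mu>)"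
    by (rule nn_integral_cmult) measurable
  finally show ?thesis .
qed

section \<open>Normalisation of the constant and assembly of the Levy measure\<close>

theorem proposition2p3:
  fixes \<iota> :: "'h::{real_inner, banach, second_countable_topology}
                \<Rightarrow> 'e::{real_inner, banach, second_countable_topology}"
    and \<mu> :: "'e measure"
    and \<alpha> :: real
  assumes "abstract_wiener_space \<iota> \<mu>"
    and "(UNIV :: 'h set) \<noteq> {0}"
    and "hilbert_schmidt \<iota>"
    and "0 < \<alpha>" and "\<alpha> < 2"
  shows "\<exists>\<Delta> :: 'e measure.
           levy_measure \<Delta> \<and> emeasure \<Delta> UNIV \<noteq> 0 \<and>
           (\<forall>\<xi> :: 'e \<Rightarrow>\<^sub>L real.
              - (norm (covariance_in \<iota> \<mu> \<xi>) powr \<alpha>)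
                = 2 * (\<integral>x. (cos (blinfun_apply \<xi> x) - 1) \<partial>\<Delta>)) \<and>
           (\<exists>\<sigma> :: 'e measure.
              finite_measure \<sigma> \<and>
              sets \<sigma> = sets (restrict_space borel (sphere (0::'e) 1)) \<and>
              (\<forall>B \<in> sets (borel :: 'e measure).
                 emeasure \<Delta> B
                   = (\<integral>\<^sup>+r\<in>{0<..}. ennreal (1 / r powr (1 + \<alpha>)) *
                        (\<integral>\<^sup>+y. indicator B (r *\<^sub>R y) \<partial>\<sigma>) \<partial>lborel)))"
proof -
  interpret abstract_wiener_space \<iota> \<mu> by fact
  have prob: "prob_space \<mu>"
    using gaussian by (simp add: centred_gaussian_measure_def)
  \<comment> \<open>A unit vector of \<open>E\<close> is needed as placeholder direction; a nonzero
    vector of \<open>H\<close> provides one, as the embedding is injective.\<close>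
  obtain h :: 'h where "h \<noteq> 0"
    using assms(2) by auto
  then have "\<iota> h \<noteq> 0"
    using bounded_linear.linear[OF embedding_bounded_linear] embedding_inj
    by (auto simp: linear_injective_0)
  define e where "e = \<iota> h /\<^sub>R norm (\<iota> h)"
  have e: "norm e = 1"
    using \<open>\<iota> h \<noteq> 0\<close> by (simp add: e_def)
  define k where "k = enn2real (cos_constant \<alpha>)"
  have k: "cos_constant \<alpha> = ennreal k" "k > 0"
    using cos_constant_finite[OF assms(4,5)] cos_constant_pos[of \<alpha>]
    by (auto simp: k_def enn2real_positive_iff)
  define m where "m = enn2real (normal_moment_powr \<alpha>)"
  have m: "normal_moment_powr \<alpha> = ennreal m" "m > 0"
    using normal_moment_powr_finite[OF assms(4,5)] normal_moment_powr_pos[of \<alpha>]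
    by (auto simp: m_def enn2real_positive_iff)
  \<comment> \<open>The integral of \<open>1 - cos\<close> will be \<open>c * k * m\<close> times
    the power of the norm; the factor 2 in the claim forces this product to be 1/2.\<close>
  define c where "c = 1 / (2 * k * m)"
  have c: "c \<ge> 0" "c * k * m = 1 / 2"
    using k m by (simp_all add: c_def)
  define \<sigma> where "\<sigma> = spherical_moment_measure e c \<alpha> \<mu>"
  have fin: "finite_measure \<sigma>"
    unfolding \<sigma>_def using sets_\<mu> e c(1) prob assms(4,5) wiener_norm_square_finite[OF assms(1,3)]
    by (rule finite_spherical_moment_measure)
  have sets: "sets \<sigma> = sets (restrict_space borel (sphere (0::'e) 1))"
    unfolding \<sigma>_def by (rule sets_spherical_moment_measure)
  define \<Delta> where "\<Delta> = radial_measure \<alpha> \<sigma>"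
  have sets_\<Delta>: "sets \<Delta> = sets borel"
    by (simp add: \<Delta>_def sets_radial_measure)
  have cos: "(\<integral>x. (cos (blinfun_apply \<xi> x) - 1) \<partial>\<Delta>) = - (norm (covariance_in \<iota> \<mu> \<xi>) powr \<alpha>) / 2" for \<xi>
  proof -
    let ?N = "norm (covariance_in \<iota> \<mu> \<xi>) powr \<alpha>"
    have "(\<integral>\<^sup>+x. ennreal (1 - cos (blinfun_apply \<xi> x)) \<partial>\<Delta>)
        = ennreal c * ennreal k * (ennreal ?N * ennreal m)"
      using nn_integral_radial_spherical_cos[OF sets_\<mu> e c(1) prob, of \<alpha> \<xi>] fin
      by (simp add: \<Delta>_def \<sigma>_def k(1) m(1) nn_integral_dual_powr)
    also have "\<dots> = ennreal (c * k * (?N * m))"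
      using c k m by (simp add: ennreal_mult)
    also have "c * k * (?N * m) = ?N / 2"
      using c(2) by (simp add: mult.assoc mult.left_commute[of _ ?N])
    finally have "enn2real (\<integral>\<^sup>+x. ennreal (1 - cos (blinfun_apply \<xi> x)) \<partial>\<Delta>) = ?N / 2"
      by simp
    moreover have "(\<lambda>x. 1 - cos (blinfun_apply \<xi> x)) \<in> borel_measurable \<Delta>"
      unfolding measurable_cong_sets[OF sets_\<Delta> refl] by measurable
    \<comment> \<open>The integrand is nonnegative, and its integral was just found finite, so no
      default value enters.\<close>
    ultimately have "(\<integral>x. (1 - cos (blinfun_apply \<xi> x)) \<partial>\<Delta>) = ?N / 2"
      by (subst integral_eq_nn_integral) auto
    then show ?thesis
      using integral_minus[of \<Delta> "\<lambda>x. 1 - cos (blinfun_apply \<xi> x)"] by simp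
  qed
  \<comment> \<open>A null measure would make every cosine integral 0 and hence the covariance
    operator zero.\<close>
  have "emeasure \<Delta> UNIV \<noteq> 0"
  proof
    assume "emeasure \<Delta> UNIV = 0"
    then have "AE x in \<Delta>. False"
      using sets_\<Delta> sets_eq_imp_space_eq[OF sets_\<Delta>] by (auto intro!: AE_I[where N=UNIV])
    then have zero: "(\<integral>x. (cos (blinfun_apply \<xi> x) - 1) \<partial>\<Delta>) = 0" for \<xi>
      by (intro integral_eq_zero_AE) (auto elim: eventually_mono)
    then have "covariance_in \<iota> \<mu> \<xi> = 0" for \<xi>
      using cos[of \<xi>] unfolding zero by simp
    then show False
      using exists_covariance_in_nonzero[OF assms(2)] by blast
  qed
  moreover have "levy_measure \<Delta>"
    unfolding \<Delta>_def by (rule levy_measure_radial_measure[OF fin sets assms(4,5)])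
  moreover have "\<forall>B\<in>sets borel. emeasure \<Delta> B
      = (\<integral>\<^sup>+r\<in>{0<..}. ennreal (1 / r powr (1 + \<alpha>)) * (\<integral>\<^sup>+y. indicator B (r *\<^sub>R y) \<partial>\<sigma>) \<partial>lborel)"
    unfolding \<Delta>_def using emeasure_radial_measure[OF fin sets] by blast
  ultimately show ?thesis
    using cos fin sets by (intro exI[of _ \<Delta>] conjI allI exI[of _ \<sigma>]) simp_all
qed

end
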